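(* Let $\Lambda>0$, $0\le\alpha\le1$ and $c\ge0$. There exists a unique trajectory of $X_c$ in $Q=\{x\ge0,\ y\le0\}$ which converges toward the origin in positive times.
   Context: $X_c$ is the vector field on $Q=\{(x,y):x\ge0,\ y\le0\}$ with differential system $x'=y$, $y'=\frac1\Lambda(cy+x^\alpha)$. Its only critical point is the origin $O=(0,0)$ (when $\alpha=0$, $x^\alpha$ is read as $1$ for $x>0$ and $0$ at $x=0$). Trajectories are nonconstant and maximal in $Q\setminus\{O\}$, and are considered up to time translation (i.e. uniqueness is that of the orbit, the geometric image). Converging toward the origin in positive times means tending to $O$ as $t$ tends to the (finite or infinite) upper end of the interval of definition. *)

theory Defs
  imports "HOL-Analysis.Analysis"
begin

definition Q :: "(real \<times> real) set" where
  "Q = {(x, y). x \<ge> 0 \<and> y \<le> 0}"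

text \<open>\<open>powr\<close> satisfies \<open>0 powr a = 0\<close> for every exponent, \<open>a = 0\<close> included, and \<open>x powr 0 = 1\<close> for
  \<open>x > 0\<close>; this is the convention wanted for \<open>\<alpha> = 0\<close>.\<close>

definition vfield :: "real \<Rightarrow> real \<Rightarrow> real \<Rightarrow> real \<times> real \<Rightarrow> real \<times> real" where
  "vfield \<Lambda> \<alpha> c = (\<lambda>(x, y). (y, (1 / \<Lambda>) * (c * y + x powr \<alpha>)))"

text \<open>The interval may contain either of its end points; there the derivative is one-sided.\<close>

definition integral_curve_on ::
  "('a::real_normed_vector \<Rightarrow> 'a) \<Rightarrow> 'a set \<Rightarrow> real set \<Rightarrow> (real \<Rightarrow> 'a) \<Rightarrow> bool" where
  "integral_curve_on X S I \<gamma> \<longleftrightarrow>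
     is_interval I \<and> \<gamma> ` I \<subseteq> S \<and>
     (\<forall>t\<in>I. (\<gamma> has_vector_derivative X (\<gamma> t)) (at t within I))"

text \<open>Being nonconstant also rules out intervals with fewer than two points, on which the
  derivative condition is void.\<close>

definition trajectory ::
  "('a::real_normed_vector \<Rightarrow> 'a) \<Rightarrow> 'a set \<Rightarrow> real set \<Rightarrow> (real \<Rightarrow> 'a) \<Rightarrow> bool" where
  "trajectory X S I \<gamma> \<longleftrightarrow>
     integral_curve_on X S I \<gamma> \<and> \<not> \<gamma> constant_on I \<and>
     (\<forall>J \<delta>. integral_curve_on X S J \<delta> \<and> I \<subseteq> J \<and> (\<forall>t\<in>I. \<delta> t = \<gamma> t) \<longrightarrow> J = I)"

definition upper_end :: "real set \<Rightarrow> real filter" where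
  "upper_end I = (if bdd_above I then at_left (Sup I) else at_top)"

end

theory Submission
  imports Defs
begin

text \<open>A trajectory tending to the origin can only touch the boundary of the quadrant at its last time,
  hence it stays in the open quadrant, where it is a graph \<open>y = - p(x)\<close> with \<open>p(0) = 0\<close> and
  \<open>\<Lambda> p p' = x\<^sup>\<alpha> - c p\<close>. For \<open>u = \<Lambda> p\<^sup>2 / 2\<close> this reads \<open>u' = x\<^sup>\<alpha> - k \<surd>u\<close> with
  \<open>k = c \<surd>(2/\<Lambda>)\<close>. The right-hand side is not Lipschitz at \<open>u = 0\<close>, but it is nonincreasing in \<open>u\<close>,
  so differences of solutions do not grow. This gives uniqueness, and it makes the solutions with
  \<open>\<surd>u\<close> regularised to \<open>\<surd>(u + e\<^sup>2)\<close> converge locally uniformly as \<open>e \<rightarrow> 0\<close>, hence existence on the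
  whole half-line \<open>x > 0\<close>. The time along the graph is recovered from \<open>dt = - dx / p(x)\<close>.\<close>

subsection \<open>Initial value problems on a half-line\<close>

lemma at_within_atLeast_eq:
  fixes a x b :: real
  assumes "x < b"
  shows "at x within {a..b} = at x within {a..}"
  by (rule at_within_nhd[where S = "{..<b}"]) (use assms in auto)

lemma integral_has_real_derivative_atLeast:
  fixes f :: "real \<Rightarrow> real"
  assumes "continuous_on {a..} f" and "a \<le> x"
  shows "((\<lambda>x. integral {a..x} f) has_real_derivative f x) (at x within {a..})"
proof -
  have "continuous_on {a..x+1} f"
    using assms(1) by (rule continuous_on_subset) auto
  from integral_has_real_derivative[OF this, of x] show ?thesis
    using assms(2) at_within_atLeast_eq[of x "x+1" a] by simp
qed

text \<open>Picard iteration is a contraction for the sup norm of \<open>exp(- M x) v(x)\<close>.\<close>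

lemma picard_global:
  fixes h :: "real \<Rightarrow> real \<Rightarrow> real"
  assumes cont: "continuous_on ({0..} \<times> UNIV) (\<lambda>(x, v). h x v)"
    and lip: "\<And>x v w. 0 \<le> x \<Longrightarrow> \<bar>h x v - h x w\<bar> \<le> L * \<bar>v - w\<bar>"
    and growth: "\<And>x. 0 \<le> x \<Longrightarrow> \<bar>h x 0\<bar> \<le> B * exp (K * x)"
  shows "\<exists>v. v 0 = 0 \<and> (\<forall>x\<ge>0. (v has_real_derivative h x (v x)) (at x within {0..}))"
proof -
  \<comment> \<open>\<open>K \<le> M\<close> lets the weight absorb the growth of
    \<open>h x 0\<close>, \<open>2 * L \<le> M\<close> gives the contraction factor
    \<open>L / M \<le> 1/2\<close>, and the 1 makes \<open>M\<close> positive.\<close>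
  define M where "M = max (max K (2 * L)) 1"
  have M: "M > 0" "K \<le> M" "2 * L \<le> M" by (auto simp: M_def)
  have L: "0 \<le> L" using lip[of 0 0 1] by simp
  have B: "0 \<le> B" using growth[of 0] by simp
  \<comment> \<open>The unknown \<open>w\<close> is the weighted function
    \<open>exp (- M s) v(s)\<close>, so \<open>G w\<close> is the right-hand side along the
    unweighted \<open>v\<close>.\<close>
  define G :: "(real \<Rightarrow>\<^sub>C real) \<Rightarrow> real \<Rightarrow> real" where "G w s = h s (exp (M * s) * w s)" for w s
  define F where "F w x = integral {0..x} (G w)" for w x
  have contG: "continuous_on {0..} (G w)" for w
    unfolding G_def
    by (rule continuous_on_compose2[OF cont, of _ "\<lambda>s. (s, exp (M * s) * w s)", simplified])
       (auto intro!: continuous_intros)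
  have derF: "(F w has_real_derivative G w x) (at x within {0..})" if "0 \<le> x" for w x
    unfolding F_def using contG that by (rule integral_has_real_derivative_atLeast)
  have intG: "G w integrable_on {0..x}" for w x
    by (rule integrable_continuous_real) (rule continuous_on_subset[OF contG], auto)
  have int_exp: "((\<lambda>s. C * exp (M * s)) has_integral C * ((exp (M * x) - 1) / M)) {0..x}"
    if "0 \<le> x" for x C
  proof -
    have "((\<lambda>s. C * exp (M * s)) has_integral C * exp (M * x) / M - C * exp (M * 0) / M) {0..x}"
      by (rule fundamental_theorem_of_calculus[OF that])
         (use M in \<open>auto intro!: derivative_eq_intros
           simp flip: has_real_derivative_iff_has_vector_derivative\<close>)
    then show ?thesis by (simp add: algebra_simps diff_divide_distrib)
  qed
  have exp_bound: "exp (- (M * x)) * (C * ((exp (M * x) - 1) / M)) \<le> C / M"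
    if "0 \<le> x" "0 \<le> C" for x C
  proof -
    have "exp (- (M * x)) * (C * ((exp (M * x) - 1) / M))
      = C / M * (1 - exp (- (M * x)))"
      by (simp add: exp_minus field_simps)
    also have "\<dots> \<le> C / M * 1" using that M by (intro mult_left_mono) auto
    finally show ?thesis by simp
  qed
  \<comment> \<open>\<open>max x 0\<close> extends the iterate by the constant 0 to negative
    arguments, so that it is a bounded continuous function on the whole real line.\<close>
  define T where "T w x = exp (- (M * max x 0)) * F w (max x 0)" for w x
  have T_bcont: "T w \<in> bcontfun" for w
  proof -
    have "continuous_on {0..} (F w)"
      using derF by (auto intro!: DERIV_continuous_on)
    then have "continuous_on UNIV (\<lambda>x. F w (max x 0))"
      by (rule continuous_on_compose2) (auto intro!: continuous_intros)
    then have "continuous_on UNIV (T w)"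
      unfolding T_def by (intro continuous_intros)
    moreover have "bounded (range (T w))"
    proof -
      obtain R where R: "\<And>x. \<bar>w x\<bar> \<le> R"
        using bounded_apply_bcontfun[of w] by (auto simp: bounded_iff)
      have R0: "0 \<le> R" using R[of 0] by simp
      have "\<bar>T w x\<bar> \<le> (B + L * R) / M" for x
      proof -
        define y where "y = max x 0"
        have y: "0 \<le> y" by (simp add: y_def)
        have "\<bar>G w s\<bar> \<le> (B + L * R) * exp (M * s)" if "s \<in> {0..y}" for s
        proof -
          have "\<bar>G w s\<bar> \<le> \<bar>h s 0\<bar> + \<bar>G w s - h s 0\<bar>" by simp
          also have "\<bar>h s 0\<bar> \<le> B * exp (K * s)" using growth that by simp
          also have "\<dots> \<le> B * exp (M * s)"
            using B M that by (intro mult_left_mono) (auto intro!: mult_right_mono)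
          also have "\<bar>G w s - h s 0\<bar> \<le> L * \<bar>exp (M * s) * w s - 0\<bar>"
            unfolding G_def using that by (intro lip) auto
          also have "\<dots> \<le> L * (exp (M * s) * R)"
            using R[of s] L by (intro mult_left_mono) (auto simp: abs_mult intro!: mult_left_mono)
          finally show ?thesis by (simp add: algebra_simps)
        qed
        then have "\<bar>F w y\<bar> \<le> (B + L * R) * ((exp (M * y) - 1) / M)"
          unfolding F_def using int_exp[OF y, of "B + L * R"] intG
          by (metis (no_types, lifting) integral_norm_bound_integral has_integral_integrable
              integral_unique real_norm_def)
        then have "\<bar>T w x\<bar> \<le> exp (- (M * y)) * ((B + L * R) * ((exp (M * y) - 1) / M))"
          unfolding T_def y_def[symmetric] abs_mult abs_exp_cancel by (rule mult_left_mono) simp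
        also have "\<dots> \<le> (B + L * R) / M"
          using B L R0 y by (intro exp_bound) auto
        finally show ?thesis .
      qed
      then show ?thesis by (auto simp: bounded_iff)
    qed
    ultimately show ?thesis by (simp add: bcontfun_def)
  qed
  define \<Phi> where "\<Phi> w = Bcontfun (T w)" for w
  have \<Phi>: "apply_bcontfun (\<Phi> w) = T w" for w
    using T_bcont by (simp add: \<Phi>_def Bcontfun_inverse)
  have contr: "dist (\<Phi> w) (\<Phi> w') \<le> 1/2 * dist w w'" for w w'
  proof (rule dist_bound)
    fix x :: real
    define y where "y = max x 0"
    have y: "0 \<le> y" by (simp add: y_def)
    define D where "D = dist w w'"
    have D: "0 \<le> D" by (simp add: D_def)
    have wD: "\<bar>w s - w' s\<bar> \<le> D" for s
      using dist_bounded[of w s w'] by (simp add: D_def dist_real_def)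
    have "\<bar>G w s - G w' s\<bar> \<le> (L * D) * exp (M * s)" if "s \<in> {0..y}" for s
    proof -
      have "\<bar>G w s - G w' s\<bar> \<le> L * \<bar>exp (M * s) * w s - exp (M * s) * w' s\<bar>"
        unfolding G_def using that by (intro lip) auto
      also have "\<dots> = L * (exp (M * s) * \<bar>w s - w' s\<bar>)"
        by (simp add: abs_mult flip: right_diff_distrib)
      also have "\<dots> \<le> L * (exp (M * s) * D)"
        using wD L by (intro mult_left_mono) auto
      finally show ?thesis by (simp add: algebra_simps)
    qed
    then have "\<bar>integral {0..y} (\<lambda>s. G w s - G w' s)\<bar> \<le> (L * D) * ((exp (M * y) - 1) / M)"
      using int_exp[OF y, of "L * D"] integrable_diff[OF intG intG]
      by (metis (no_types, lifting) integral_norm_bound_integral has_integral_integrable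
          integral_unique real_norm_def)
    then have "\<bar>F w y - F w' y\<bar> \<le> (L * D) * ((exp (M * y) - 1) / M)"
      unfolding F_def using intG by (simp add: integral_diff)
    then have "dist (T w x) (T w' x) \<le> exp (- (M * y)) * ((L * D) * ((exp (M * y) - 1) / M))"
      unfolding T_def y_def[symmetric] dist_real_def right_diff_distrib[symmetric] abs_mult
        abs_exp_cancel
      by (rule mult_left_mono) simp
    also have "\<dots> \<le> L * D / M"
      using L D y by (intro exp_bound) auto
    also have "\<dots> \<le> 1/2 * D"
      using mult_right_mono[OF M(3) D] M(1) by (simp add: field_simps)
    finally show "dist (\<Phi> w x) (\<Phi> w' x) \<le> 1/2 * dist w w'"
      by (simp add: \<Phi> D_def)
  qed
  obtain w where w: "\<Phi> w = w"
    using banach_fix_type[of "1/2" \<Phi>] contr by auto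
  \<comment> \<open>Removing the weight from the fixed point gives \<open>F w\<close>, so the
    derivative \<open>G w\<close> of \<open>F w\<close> becomes \<open>h\<close> along
    \<open>F w\<close> itself.\<close>
  have wF: "exp (M * s) * w s = F w s" if "0 \<le> s" for s
  proof -
    have "w s = T w s" using \<Phi>[of w] w by simp
    also have "\<dots> = exp (- (M * s)) * F w s" using that by (simp add: T_def)
    finally show ?thesis by (simp add: exp_minus field_simps)
  qed
  show ?thesis
  proof (intro exI[of _ "F w"] conjI allI impI)
    show "F w 0 = 0" by (simp add: F_def)
    fix x :: real assume "0 \<le> x"
    then show "(F w has_real_derivative h x (F w x)) (at x within {0..})"
      using derF[of x w] wF[of x] by (simp add: G_def)
  qed
qed

section \<open>Comparison principle on the half-line\<close>

text \<open>A derivative bound where \<open>w\<close> is positive suffices: if \<open>w x\<close>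
  exceeded \<open>m * x\<close>, then after the last point of \<open>{0..x}\<close> with
  \<open>w \<le> 0\<close> the bound would hold up to \<open>x\<close>, and the mean value theorem
  on that stretch gives a contradiction.\<close>

lemma le_linear_of_derivative_le:
  fixes w w' :: "real \<Rightarrow> real"
  assumes cont: "continuous_on {0..} w" and w0: "w 0 \<le> 0" and m: "0 \<le> m" and x: "0 \<le> x"
    and der: "\<And>z. 0 < z \<Longrightarrow> (w has_real_derivative w' z) (at z)"
    and le: "\<And>z. 0 < z \<Longrightarrow> 0 < w z \<Longrightarrow> w' z \<le> m"
  shows "w x \<le> m * x"
proof (rule ccontr)
  assume neg: "\<not> w x \<le> m * x"
  define S where "S = {0..x} \<inter> w -` {..0}"
  have "closed S"
    unfolding S_def
    by (rule continuous_closed_preimage)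
      (use cont in \<open>auto intro: continuous_on_subset\<close>)
  then have "compact S" unfolding S_def
    by (metis S_def bounded_closed_interval bounded_subset compact_eq_bounded_closed inf_le1)
  moreover have "0 \<in> S" using x w0 by (simp add: S_def)
  ultimately obtain a where a: "a \<in> S" "\<And>s. s \<in> S \<Longrightarrow> s \<le> a"
    using compact_attains_sup[of S] by blast
  have mx: "0 \<le> m * x" using m x by simp
  have ax: "0 \<le> a" "w a \<le> 0" "a < x"
    using a(1) neg mx by (auto simp: S_def less_le)
  have pos: "0 < w z" if "a < z" "z \<le> x" for z
    using a(2)[of z] that ax by (auto simp: S_def not_le[symmetric])
  obtain z where z: "a < z" "z < x" "w x - w a = (x - a) * w' z"
  proof -
    have "continuous_on {a..x} w" using cont by (rule continuous_on_subset) (use ax in auto)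
    moreover have "(w has_derivative (*) (w' z)) (at z)" if "a < z" "z < x" for z
      using der[of z] that ax by (simp add: has_field_derivative_def)
    ultimately show ?thesis
      using mvt[OF ax(3), of w "\<lambda>z. (*) (w' z)"] that by (auto simp: mult.commute)
  qed
  have "(x - a) * w' z \<le> (x - a) * m"
    using le[of z] pos[of z] z ax by (intro mult_left_mono) auto
  also have "\<dots> \<le> m * x" using m ax by (simp add: algebra_simps)
  finally show False using z ax neg by linarith
qed

subsection \<open>The equation for the profile\<close>

lemma powr_antiderivative:
  fixes \<alpha> x :: real
  assumes "0 < x" and "0 \<le> \<alpha>"
  shows "((\<lambda>x. x powr (1 + \<alpha>) / (1 + \<alpha>)) has_real_derivative x powr \<alpha>) (at x)"
proof -
  have "((\<lambda>x. x powr (1 + \<alpha>)) has_real_derivative (1 + \<alpha>) * x powr (1 + \<alpha> - 1)) (at x)"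
    using assms by (intro has_real_derivative_powr)
  from DERIV_cdivide[OF this, of "1 + \<alpha>"] show ?thesis
    using assms by simp
qed

text \<open>Factor \<open>a - b\<close> as a difference of squares; the sum of the roots is at least
  \<open>e\<close>. This makes the regularised root globally Lipschitz.\<close>

lemma abs_sqrt_diff_le:
  fixes a b e :: real
  assumes "0 < e" "e\<^sup>2 \<le> a" "e\<^sup>2 \<le> b"
  shows "\<bar>sqrt a - sqrt b\<bar> \<le> 1 / e * \<bar>a - b\<bar>"
proof -
  have s: "e \<le> sqrt a" "e \<le> sqrt b" using assms by (auto intro: real_le_rsqrt)
  have ab: "0 \<le> a" "0 \<le> b" using assms zero_le_power2[of e] by linarith+
  have "\<bar>a - b\<bar> = \<bar>sqrt a - sqrt b\<bar> * (sqrt a + sqrt b)"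
  proof -
    have "a - b = (sqrt a - sqrt b) * (sqrt a + sqrt b)"
      using ab by (simp add: algebra_simps)
    then show ?thesis using ab by (simp add: abs_mult)
  qed
  also have "\<dots> \<ge> \<bar>sqrt a - sqrt b\<bar> * e"
    using s assms by (intro mult_left_mono) auto
  finally show ?thesis using assms by (simp add: field_simps)
qed

text \<open>Writing \<open>u = g + v\<close> with \<open>g' = x\<^sup>\<alpha>\<close> keeps the right-hand side continuous at \<open>x = 0\<close> even for
  \<open>\<alpha> = 0\<close>, where \<open>x powr \<alpha>\<close> jumps.\<close>

lemma regularized_solution_exists:
  fixes g :: "real \<Rightarrow> real"
  assumes g: "continuous_on {0..} g" "\<And>x. 0 \<le> x \<Longrightarrow> 0 \<le> g x"
    and growth: "\<And>x. 0 \<le> x \<Longrightarrow> sqrt (g x) \<le> exp (K * x)"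
    and k: "0 \<le> k" and K: "0 \<le> K" and e: "0 < e"
  shows "\<exists>v. v 0 = 0 \<and>
    (\<forall>x\<ge>0. (v has_real_derivative - k * sqrt (max 0 (g x + v x) + e\<^sup>2)) (at x within {0..}))"
proof (rule picard_global)
  have "continuous_on ({0..} \<times> UNIV) (\<lambda>z. g (fst z) :: real)"
    by (rule continuous_on_compose2[OF g(1)]) (auto intro!: continuous_intros)
  then show "continuous_on ({0..} \<times> UNIV) (\<lambda>(x, v). - k * sqrt (max 0 (g x + v) + e\<^sup>2))"
    unfolding case_prod_unfold by (intro continuous_intros)
  fix x :: real assume x: "0 \<le> x"
  show "\<bar>- k * sqrt (max 0 (g x + v) + e\<^sup>2) - - k * sqrt (max 0 (g x + w) + e\<^sup>2)\<bar>
    \<le> k / e * \<bar>v - w\<bar>" for v w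
  proof -
    have "\<bar>- k * sqrt (max 0 (g x + v) + e\<^sup>2) - - k * sqrt (max 0 (g x + w) + e\<^sup>2)\<bar>
      = k * \<bar>sqrt (max 0 (g x + v) + e\<^sup>2) - sqrt (max 0 (g x + w) + e\<^sup>2)\<bar>"
      using k by (simp add: abs_mult abs_minus_commute flip: right_diff_distrib)
    also have "\<dots> \<le> k * (1 / e * \<bar>(max 0 (g x + v) + e\<^sup>2) - (max 0 (g x + w) + e\<^sup>2)\<bar>)"
      using k e by (intro mult_left_mono abs_sqrt_diff_le) auto
    also have "\<dots> \<le> k * (1 / e * \<bar>v - w\<bar>)"
      using k e by (intro mult_left_mono) auto
    finally show ?thesis by simp
  qed
  have "\<bar>- k * sqrt (max 0 (g x + 0) + e\<^sup>2)\<bar> = k * sqrt (g x + e\<^sup>2)"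
    using k g(2)[OF x] by (simp add: abs_mult)
  also have "\<dots> \<le> k * (exp (K * x) + e * exp (K * x))"
  proof (rule mult_left_mono[OF _ k])
    have "sqrt (g x + e\<^sup>2) \<le> sqrt (g x) + e"
      using sqrt_add_le_add_sqrt[of "g x" "e\<^sup>2"] g(2)[OF x] e by simp
    also have "\<dots> \<le> exp (K * x) + e * exp (K * x)"
    proof (rule add_mono[OF growth[OF x]])
      show "e \<le> e * exp (K * x)" using e K x mult_left_mono[of 1 "exp (K * x)" e] by simp
    qed
    finally show "sqrt (g x + e\<^sup>2) \<le> exp (K * x) + e * exp (K * x)" .
  qed
  finally show "\<bar>- k * sqrt (max 0 (g x + 0) + e\<^sup>2)\<bar> \<le> (k * (1 + e)) * exp (K * x)"
    by (simp add: algebra_simps)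
qed

section \<open>Removal of the regularisation\<close>

lemma sqrt_add_power2_bounds:
  fixes a e :: real
  assumes "0 \<le> a" "0 \<le> e"
  shows "sqrt a \<le> sqrt (a + e\<^sup>2)" "sqrt (a + e\<^sup>2) \<le> sqrt a + e"
  using assms sqrt_add_le_add_sqrt[of a "e\<^sup>2"] by auto

text \<open>The right-hand side is nonincreasing in the unknown, so where \<open>v\<close> exceeds
  \<open>w\<close> only the difference of the two regularisations can make \<open>v - w\<close>
  grow, at rate at most \<open>k * m\<close>. The Lipschitz constant, which blows up as
  \<open>e\<close> tends to 0, does not enter.\<close>

lemma regularized_diff_le:
  fixes g v w :: "real \<Rightarrow> real"
  assumes v: "v 0 = 0"
      "\<And>x. 0 \<le> x \<Longrightarrow> (v has_real_derivative - k * sqrt (max 0 (g x + v x) + e\<^sup>2)) (at x within {0..})"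
    and w: "w 0 = 0"
      "\<And>x. 0 \<le> x \<Longrightarrow> (w has_real_derivative - k * sqrt (max 0 (g x + w x) + d\<^sup>2)) (at x within {0..})"
    and k: "0 \<le> k" and e: "0 \<le> e" "e \<le> m" and d: "0 \<le> d" "d \<le> m" and x: "0 \<le> x"
  shows "v x - w x \<le> k * m * x"
proof (rule le_linear_of_derivative_le[where w = "\<lambda>x. v x - w x"
      and w' = "\<lambda>x. - k * sqrt (max 0 (g x + v x) + e\<^sup>2)
      - - k * sqrt (max 0 (g x + w x) + d\<^sup>2)"])
  show "continuous_on {0..} (\<lambda>x. v x - w x)"
    using v(2) w(2) by (intro continuous_intros) (auto intro!: DERIV_continuous_on)
  show "v 0 - w 0 \<le> 0" using v w by simp
  show "0 \<le> k * m" using k e by simp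
  show "0 \<le> x" by (rule x)
  fix z :: real assume z: "0 < z"
  then have "at z within {0..} = at z"
    by (intro at_within_interior) simp
  then show "((\<lambda>x. v x - w x) has_real_derivative - k * sqrt (max 0 (g z + v z) + e\<^sup>2)
      - - k * sqrt (max 0 (g z + w z) + d\<^sup>2)) (at z)"
    using v(2)[of z] w(2)[of z] z by (intro DERIV_diff) auto
  assume "0 < v z - w z"
  then have "sqrt (max 0 (g z + w z) + d\<^sup>2) \<le> sqrt (max 0 (g z + v z) + d\<^sup>2)" by simp
  also have "\<dots> \<le> sqrt (max 0 (g z + v z)) + d" using d by (intro sqrt_add_power2_bounds) auto
  also have "\<dots> \<le> sqrt (max 0 (g z + v z) + e\<^sup>2) + m"
    using d e by (intro add_mono sqrt_add_power2_bounds) auto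
  finally have "k * sqrt (max 0 (g z + w z) + d\<^sup>2) \<le> k * (sqrt (max 0 (g z + v z) + e\<^sup>2) + m)"
    by (rule mult_left_mono[OF _ k])
  then show "- k * sqrt (max 0 (g z + v z) + e\<^sup>2) - - k * sqrt (max 0 (g z + w z) + d\<^sup>2) \<le> k * m"
    by (simp add: algebra_simps)
qed

text \<open>Subadditivity makes the root Hoelder continuous with exponent 1/2; the regularisation
  adds an error of at most \<open>e\<close>.\<close>

lemma abs_sqrt_regularized_diff_le:
  fixes a b e :: real
  assumes "0 \<le> e"
  shows "\<bar>sqrt (max 0 a + e\<^sup>2) - sqrt (max 0 b)\<bar> \<le> sqrt \<bar>a - b\<bar> + e"
proof -
  have "max 0 a \<le> max 0 b + \<bar>a - b\<bar>" "max 0 b \<le> max 0 a + \<bar>a - b\<bar>" by auto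
  then have "sqrt (max 0 a) \<le> sqrt (max 0 b + \<bar>a - b\<bar>)" "sqrt (max 0 b) \<le> sqrt (max 0 a + \<bar>a - b\<bar>)"
    by (simp_all only: real_sqrt_le_iff)
  moreover have "sqrt (max 0 b + \<bar>a - b\<bar>) \<le> sqrt (max 0 b) + sqrt \<bar>a - b\<bar>"
    "sqrt (max 0 a + \<bar>a - b\<bar>) \<le> sqrt (max 0 a) + sqrt \<bar>a - b\<bar>"
    by (intro sqrt_add_le_add_sqrt; simp)+
  moreover have "sqrt (max 0 a) \<le> sqrt (max 0 a + e\<^sup>2)" "sqrt (max 0 a + e\<^sup>2) \<le> sqrt (max 0 a) + e"
    using assms by (intro sqrt_add_power2_bounds; simp)+
  ultimately show ?thesis using assms by linarith
qed

text \<open>The regularised solutions are Cauchy at a rate that is uniform on bounded intervals.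
  Their derivatives therefore converge uniformly there, and the limit solves the limit
  equation.\<close>

lemma sqrt_damped_solution_exists:
  fixes g :: "real \<Rightarrow> real"
  assumes g: "continuous_on {0..} g" "\<And>x. 0 \<le> x \<Longrightarrow> 0 \<le> g x"
    and growth: "\<And>x. 0 \<le> x \<Longrightarrow> sqrt (g x) \<le> exp (K * x)"
    and k: "0 \<le> k" and K: "0 \<le> K"
  shows "\<exists>v. v 0 = 0 \<and>
    (\<forall>x\<ge>0. (v has_real_derivative - k * sqrt (max 0 (g x + v x))) (at x within {0..}))"
proof -
  define e where "e n = inverse (real (Suc n))" for n
  have e: "0 < e n" for n by (simp add: e_def)
  have e_lim: "e \<longlonglongrightarrow> 0" unfolding e_def by (rule LIMSEQ_inverse_real_of_nat)
  have e_anti: "e n \<le> e m" if "m \<le> n" for m n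
    using that by (simp add: e_def)
  have "\<exists>v. \<forall>n. v n 0 = 0 \<and> (\<forall>x\<ge>0. (v n has_real_derivative
      - k * sqrt (max 0 (g x + v n x) + (e n)\<^sup>2)) (at x within {0..}))"
    using regularized_solution_exists[OF g growth k K e] by (intro choice) blast
  then obtain v where v0: "\<And>n. v n 0 = 0"
    and dv: "\<And>n x. 0 \<le> x \<Longrightarrow> (v n has_real_derivative
      - k * sqrt (max 0 (g x + v n x) + (e n)\<^sup>2)) (at x within {0..})"
    by blast
  \<comment> \<open>For \<open>m \<le> n\<close> the larger parameter is \<open>e m\<close>; the
    comparison is used in both directions.\<close>
  have diff: "\<bar>v n x - v m x\<bar> \<le> k * e m * x" if "m \<le> n" "0 \<le> x" for m n x
    using regularized_diff_le[OF v0 dv v0 dv k, of n "e m" m x]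
      regularized_diff_le[OF v0 dv v0 dv k, of m "e m" n x] that e[of n] e[of m] e_anti
    by (simp add: abs_le_iff less_imp_le)
  have kex: "(\<lambda>m. k * e m * x) \<longlonglongrightarrow> 0" for x
    using tendsto_mult[OF tendsto_mult[OF tendsto_const[of k] e_lim] tendsto_const[of x]] by simp
  have "convergent (\<lambda>n. v n x)" if "0 \<le> x" for x
  proof (rule Cauchy_convergent, rule metric_CauchyI)
    fix d :: real assume "0 < d"
    then have "\<forall>\<^sub>F m in sequentially. k * e m * x < d / 2"
      using order_tendstoD(2)[OF kex[of x], of "d / 2"] by simp
    then obtain M where M: "k * e M * x < d / 2" by (auto simp: eventually_sequentially)
    have "dist (v m x) (v n x) < d" if "M \<le> m" "M \<le> n" for m n
      using diff[OF \<open>M \<le> m\<close> \<open>0 \<le> x\<close>] diff[OF \<open>M \<le> n\<close> \<open>0 \<le> x\<close>] M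
      by (simp add: dist_real_def)
    then show "\<exists>M. \<forall>m\<ge>M. \<forall>n\<ge>M. dist (v m x) (v n x) < d" by blast
  qed
  then obtain u where u: "\<And>x. 0 \<le> x \<Longrightarrow> (\<lambda>n. v n x) \<longlonglongrightarrow> u x"
    unfolding convergent_def by metis
  \<comment> \<open>Let \<open>n\<close> tend to infinity in \<open>diff\<close>.\<close>
  have diff_u: "\<bar>v m x - u x\<bar> \<le> k * e m * x" if "0 \<le> x" for m x
  proof (rule tendsto_upperbound[of "\<lambda>n. \<bar>v m x - v n x\<bar>" _ sequentially])
    show "(\<lambda>n. \<bar>v m x - v n x\<bar>) \<longlonglongrightarrow> \<bar>v m x - u x\<bar>"
      using u[OF that] by (intro tendsto_intros)
    show "\<forall>\<^sub>F n in sequentially. \<bar>v m x - v n x\<bar> \<le> k * e m * x"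
      using eventually_ge_at_top[of m] by eventually_elim (metis abs_minus_commute diff that)
  qed simp
  have du: "(u has_real_derivative - k * sqrt (max 0 (g x + u x))) (at x within {0..})"
    if x: "0 \<le> x" for x
  proof -
    \<comment> \<open>The convergence rate grows with \<open>x\<close>, so a bounded interval is
      used. Its right end lies beyond \<open>x\<close>, so the derivative at \<open>x\<close> within
      \<open>S\<close> is the one within the half-line.\<close>
    define S where "S = {0..x+1}"
    have "\<exists>f. \<forall>y\<in>S. (\<lambda>n. v n y) \<longlonglongrightarrow> f y \<and>
        (f has_derivative (*) (- k * sqrt (max 0 (g y + u y)))) (at y within S)"
    proof (rule has_derivative_sequence)
      show "convex S" by (simp add: S_def)
      show "(v n has_derivative (*) (- k * sqrt (max 0 (g y + v n y) + (e n)\<^sup>2))) (at y within S)"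
        if "y \<in> S" for n y
        using has_derivative_subset[OF dv[of y n, unfolded has_field_derivative_def], of S] that
        by (auto simp: S_def)
      show "0 \<in> S" using x by (simp add: S_def)
      show "(\<lambda>n. v n 0) \<longlonglongrightarrow> 0" by (simp add: v0)
      fix d :: real assume d: "0 < d"
      \<comment> \<open>This quantity bounds the difference of the derivatives on \<open>S\<close>:
        the Hoelder estimate is applied to \<open>diff_u\<close> with
        \<open>y \<le> x + 1\<close>.\<close>
      have "(\<lambda>n. k * (sqrt (k * e n * (x + 1)) + e n)) \<longlonglongrightarrow> k * (sqrt 0 + 0)"
        by (intro tendsto_intros kex e_lim)
      then have "\<forall>\<^sub>F n in sequentially. k * (sqrt (k * e n * (x + 1)) + e n) < d"
        using order_tendstoD(2) d by fastforce
      then show "\<forall>\<^sub>F n in sequentially. \<forall>y\<in>S. \<forall>h.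
          norm (- k * sqrt (max 0 (g y + v n y) + (e n)\<^sup>2) * h - - k * sqrt (max 0 (g y + u y)) * h)
            \<le> d * norm h"
      proof eventually_elim
        case (elim n)
        show ?case
        proof (intro ballI allI)
          fix y h assume y: "y \<in> S"
          have "\<bar>(g y + v n y) - (g y + u y)\<bar> \<le> k * e n * y"
            using diff_u[of y n] y by (simp add: S_def)
          also have "\<dots> \<le> k * e n * (x + 1)"
            using k e[of n] y by (intro mult_left_mono) (auto simp: S_def)
          finally have "sqrt \<bar>(g y + v n y) - (g y + u y)\<bar> \<le> sqrt (k * e n * (x + 1))" by simp
          then have "\<bar>sqrt (max 0 (g y + v n y) + (e n)\<^sup>2) - sqrt (max 0 (g y + u y))\<bar>
              \<le> sqrt (k * e n * (x + 1)) + e n"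
            using abs_sqrt_regularized_diff_le[of "e n" "g y + v n y" "g y + u y"] e[of n] by linarith
          then have "k * \<bar>sqrt (max 0 (g y + v n y) + (e n)\<^sup>2) - sqrt (max 0 (g y + u y))\<bar> \<le> d"
            using mult_left_mono[OF _ k] elim by fastforce
          then have "k * \<bar>sqrt (max 0 (g y + v n y) + (e n)\<^sup>2) - sqrt (max 0 (g y + u y))\<bar> * \<bar>h\<bar> \<le> d * \<bar>h\<bar>"
            by (rule mult_right_mono) simp
          moreover have "- k * sqrt (max 0 (g y + v n y) + (e n)\<^sup>2) * h - - k * sqrt (max 0 (g y + u y)) * h
            = - (k * (sqrt (max 0 (g y + v n y) + (e n)\<^sup>2) - sqrt (max 0 (g y + u y))) * h)"
            by (simp add: algebra_simps)
          ultimately show "norm (- k * sqrt (max 0 (g y + v n y) + (e n)\<^sup>2) * h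
              - - k * sqrt (max 0 (g y + u y)) * h) \<le> d * norm h"
            using k by (simp add: abs_mult)
        qed
      qed
    qed
    then obtain f where f: "\<And>y. y \<in> S \<Longrightarrow> (\<lambda>n. v n y) \<longlonglongrightarrow> f y"
      "\<And>y. y \<in> S \<Longrightarrow> (f has_real_derivative - k * sqrt (max 0 (g y + u y))) (at y within S)"
      unfolding has_field_derivative_def by blast
    have fu: "f y = u y" if "y \<in> S" for y
      using LIMSEQ_unique[OF f(1)[OF that] u] that by (auto simp: S_def)
    have xS: "x \<in> S" using x by (simp add: S_def)
    have "(u has_real_derivative - k * sqrt (max 0 (g x + u x))) (at x within S)"
      by (rule has_field_derivative_transform_within[OF f(2)[OF xS] zero_less_one xS]) (simp add: fu)
    then show ?thesis
      using at_within_atLeast_eq[of x "x + 1" 0] by (simp add: S_def)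
  qed
  have "u 0 = 0" using LIMSEQ_unique[OF u[of 0]] by (simp add: v0)
  with du show ?thesis by blast
qed

text \<open>The truncation \<open>max 0\<close> under the root disappears once the solution is known
  to be positive for \<open>x > 0\<close>.\<close>

lemma power_profile_exists:
  fixes \<alpha> k :: real
  assumes \<alpha>: "0 \<le> \<alpha>" "\<alpha> \<le> 1" and k: "0 \<le> k"
  obtains u where "continuous_on {0..} u" "u 0 = 0" "\<And>x. 0 < x \<Longrightarrow> 0 < u x"
    "\<And>x. 0 < x \<Longrightarrow> (u has_real_derivative x powr \<alpha> - k * sqrt (u x)) (at x)"
proof -
  define g where "g x = x powr (1 + \<alpha>) / (1 + \<alpha>)" for x
  have g: "continuous_on {0..} g" "\<And>x. 0 \<le> x \<Longrightarrow> 0 \<le> g x"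
    unfolding g_def using \<alpha> by (auto intro!: continuous_intros continuous_on_powr')
  \<comment> \<open>\<open>x \<le> exp x\<close> and \<open>1 + \<alpha> \<le> 2\<close> bound
    \<open>g x\<close> by \<open>exp (x * 2)\<close>.\<close>
  have growth: "sqrt (g x) \<le> exp (1 * x)" if x: "0 \<le> x" for x
  proof (rule real_le_lsqrt)
    have "g x \<le> x powr (1 + \<alpha>)"
      using \<alpha> mult_left_mono[of 1 "1 + \<alpha>" "x powr (1 + \<alpha>)"] by (simp add: g_def divide_le_eq)
    also have "\<dots> \<le> exp x powr (1 + \<alpha>)"
      using x \<alpha> exp_ge_add_one_self[of x] by (intro powr_mono2) linarith+
    also have "\<dots> \<le> exp (x * 2)"
      using x \<alpha> by (auto simp: powr_def intro!: mult_left_mono simp: mult.commute)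
    also have "\<dots> = (exp (1 * x))\<^sup>2" by (simp add: power2_eq_square mult_2_right flip: exp_add)
    finally show "g x \<le> (exp (1 * x))\<^sup>2" .
  qed (use g x in auto)
  obtain v where v0: "v 0 = 0" and dv: "\<And>x. 0 \<le> x \<Longrightarrow>
      (v has_real_derivative - k * sqrt (max 0 (g x + v x))) (at x within {0..})"
    using sqrt_damped_solution_exists[OF g growth k] by auto
  define u where "u x = g x + v x" for x
  have u_cont: "continuous_on {0..} u"
    unfolding u_def using dv by (intro continuous_intros g) (auto intro!: DERIV_continuous_on)
  have u0: "u 0 = 0" by (simp add: u_def g_def v0)
  have du: "(u has_real_derivative x powr \<alpha> - k * sqrt (max 0 (u x))) (at x)" if x: "0 < x" for x
  proof -
    have "at x within {0..} = at x" using x by (intro at_within_interior) simp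
    then show ?thesis
      unfolding u_def g_def
      using DERIV_add[OF powr_antiderivative[OF x \<alpha>(1)]] dv[of x] x
      unfolding u_def g_def by fastforce
  qed
  \<comment> \<open>Where \<open>u\<close> is negative the truncated root vanishes and
    \<open>- u\<close> has derivative \<open>- (z powr \<alpha>) \<le> 0\<close>, so the comparison
    principle applies with slope 0.\<close>
  have u_nonneg: "0 \<le> u x" if "0 \<le> x" for x
  proof -
    have "- u x \<le> 0 * x"
    proof (rule le_linear_of_derivative_le[OF _ _ _ that])
      show "((\<lambda>x. - u x) has_real_derivative - (z powr \<alpha> - k * sqrt (max 0 (u z)))) (at z)"
        if "0 < z" for z using du[OF that] by (rule DERIV_minus)
    qed (use u_cont u0 in \<open>auto intro!: continuous_intros\<close>)
    then show ?thesis by simp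
  qed
  \<comment> \<open>At a zero \<open>x > 0\<close> the derivative would be
    \<open>x powr \<alpha> > 0\<close>, forcing negative values just to the left.\<close>
  have u_pos: "0 < u x" if x: "0 < x" for x
  proof (rule ccontr)
    assume "\<not> 0 < u x"
    then have ux: "u x = 0" using u_nonneg[of x] x by simp
    then have "(u has_real_derivative x powr \<alpha>) (at x)" using du[OF x] by simp
    from DERIV_pos_inc_left[OF this] x obtain d where d: "0 < d"
        "\<And>h. 0 < h \<Longrightarrow> h < d \<Longrightarrow> u (x - h) < u x" by auto
    \<comment> \<open>The step is shorter than \<open>d\<close> and does not pass 0.\<close>
    have "u (x - min (d / 2) x) < 0" using d(2)[of "min (d / 2) x"] d(1) x ux by auto
    with u_nonneg[of "x - min (d / 2) x"] show False by simp
  qed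
  show ?thesis
  proof (rule that[OF u_cont u0 u_pos])
    show "(u has_real_derivative x powr \<alpha> - k * sqrt (u x)) (at x)" if "0 < x" for x
      using du[OF that] u_pos[OF that] by (simp add: max_def)
  qed
qed

section \<open>The orbit as a graph\<close>

text \<open>The equation is the quotient of the two components of the field along
  \<open>y = - p(x)\<close>. It is required only for \<open>x > 0\<close> because its denominator
  vanishes at 0, where continuity is enough.\<close>

locale orbit_profile =
  fixes \<Lambda> \<alpha> c :: real and p :: "real \<Rightarrow> real"
  assumes \<Lambda>: "0 < \<Lambda>" and c: "0 \<le> c"
    and p_cont: "continuous_on {0..} p" and p0: "p 0 = 0"
    and p_pos: "\<And>x. 0 < x \<Longrightarrow> 0 < p x"
    and p_der: "\<And>x. 0 < x \<Longrightarrow> (p has_real_derivative (x powr \<alpha> - c * p x) / (\<Lambda> * p x)) (at x)"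

text \<open>Solve \<open>u = \<Lambda> p^2 / 2\<close> for \<open>p\<close>; the constant
  \<open>k\<close> is chosen so that \<open>k * sqrt (u x) = c * p x\<close>.\<close>

lemma orbit_profile_exists:
  assumes "0 < \<Lambda>" "0 \<le> \<alpha>" "\<alpha> \<le> 1" "0 \<le> c"
  obtains p where "orbit_profile \<Lambda> \<alpha> c p"
proof -
  define k where "k = c * sqrt (2 / \<Lambda>)"
  have "0 \<le> k" using assms by (simp add: k_def)
  then obtain u where u: "continuous_on {0..} u" "u 0 = 0" "\<And>x. 0 < x \<Longrightarrow> 0 < u x"
    "\<And>x. 0 < x \<Longrightarrow> (u has_real_derivative x powr \<alpha> - k * sqrt (u x)) (at x)"
    using power_profile_exists assms by metis
  define p where "p x = sqrt (2 / \<Lambda> * u x)" for x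
  have "orbit_profile \<Lambda> \<alpha> c p"
  proof
    show "0 < \<Lambda>" "0 \<le> c" using assms by auto
    show "continuous_on {0..} p" unfolding p_def by (intro continuous_intros u)
    show "p 0 = 0" by (simp add: p_def u)
    show pos: "0 < p x" if "0 < x" for x using u(3)[OF that] assms by (simp add: p_def)
    show "(p has_real_derivative (x powr \<alpha> - c * p x) / (\<Lambda> * p x)) (at x)" if x: "0 < x" for x
    proof -
      have k: "k * sqrt (u x) = c * p x" by (simp add: k_def p_def flip: real_sqrt_mult)
      have "((\<lambda>x. sqrt (2 / \<Lambda> * u x)) has_real_derivative
          (inverse (sqrt (2 / \<Lambda> * u x)) / 2) * (2 / \<Lambda> * (x powr \<alpha> - k * sqrt (u x)))) (at x)"
        using u(3)[OF x] assms
        by (intro DERIV_chain'[OF DERIV_cmult[OF u(4)[OF x]] DERIV_real_sqrt]) auto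
      moreover have "(inverse (p x) / 2) * (2 / \<Lambda> * (x powr \<alpha> - c * p x))
          = (x powr \<alpha> - c * p x) / (\<Lambda> * p x)"
        using pos[OF x] assms by (simp add: field_simps)
      ultimately show ?thesis unfolding k p_def[symmetric] by simp
    qed
  qed
  then show ?thesis by (rule that)
qed

subsection \<open>Parametrisation of the arc by time\<close>

text \<open>The second point \<open>t\<close> keeps \<open>s\<close> strictly below the upper end,
  so times near that end lie in \<open>I\<close>, whether or not the supremum belongs to
  \<open>I\<close>.\<close>

lemma eventually_upper_end:
  assumes "is_interval I" "s \<in> I" "t \<in> I" "s < t"
  shows "\<forall>\<^sub>F r in upper_end I. r \<in> I \<and> s < r"
proof (cases "bdd_above I")
  case True
  have "s < Sup I" using cSup_upper[OF assms(3) True] assms(4) by simp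
  then have "\<forall>\<^sub>F r in at_left (Sup I). r \<in> {s<..<Sup I}"
    by (rule eventually_at_leftI[rotated])
  moreover have "r \<in> I" if r: "s < r" "r < Sup I" for r
  proof -
    obtain r' where "r' \<in> I" "r < r'" using r(2) less_cSup_iff[OF _ True] assms(2) by auto
    with r assms show ?thesis by (metis less_imp_le mem_is_interval_1_I)
  qed
  ultimately show ?thesis
    unfolding upper_end_def using True by (auto elim!: eventually_mono)
next
  case False
  have "r \<in> I" if "s < r" for r
    using False that assms by (metis bdd_above.I2 bdd_aboveI linear less_imp_le mem_is_interval_1_I)
  with False show ?thesis
    unfolding upper_end_def by (auto intro: eventually_mono[OF eventually_gt_at_top[of s]])
qed

lemma upper_end_neq_bot: "upper_end I \<noteq> bot"
  by (simp add: upper_end_def)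

context orbit_profile
begin

definition arc_point :: "real \<Rightarrow> real \<times> real" where
  "arc_point x = (x, - p x)"

lemma arc_point_tendsto: "(arc_point \<longlongrightarrow> (0, 0)) (at_right 0)"
proof -
  have "(p \<longlongrightarrow> 0) (at_right 0)"
    using p_cont[unfolded continuous_on_def, rule_format, of 0] p0
    by (simp add: at_within_Ici_at_right)
  then show ?thesis
    unfolding arc_point_def by (auto intro!: tendsto_eq_intros)
qed

lemma p_isCont: "0 < x \<Longrightarrow> isCont p x"
  using p_der by (blast intro: DERIV_isCont)

lemma transit_time_exists:
  obtains \<tau> where "\<And>x. 0 < x \<Longrightarrow> (\<tau> has_real_derivative - 1 / p x) (at x)"
proof -
  \<comment> \<open>Since \<open>p 0 = 0\<close>, the function \<open>1 / p\<close> may fail to be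
    integrable at 0; hence an antiderivative on the open half-line rather than an integral from
    0.\<close>
  have "\<exists>F. \<forall>x::real. ereal 0 < ereal x \<longrightarrow> ereal x < \<infinity> \<longrightarrow> (F has_vector_derivative - 1 / p x) (at x)"
    by (rule einterval_antiderivative) (auto intro!: continuous_intros p_isCont dest: p_pos)
  then show ?thesis
    using that by (auto simp: has_real_derivative_iff_has_vector_derivative)
qed

end

section \<open>The orbit as a function of time\<close>

text \<open>\<open>\<tau> x\<close> is the time at which the orbit has abscissa \<open>x\<close>. It
  is determined up to an additive constant, which is the freedom of time translation.\<close>

locale timed_orbit_profile = orbit_profile +
  fixes \<tau> :: "real \<Rightarrow> real"
  assumes \<tau>_der: "\<And>x. 0 < x \<Longrightarrow> (\<tau> has_real_derivative - 1 / p x) (at x)"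
begin

lemma \<tau>_strict_anti:
  assumes "0 < x" "x < z"
  shows "\<tau> z < \<tau> x"
proof (rule DERIV_neg_imp_decreasing[OF assms(2)])
  fix r assume "x \<le> r" "r \<le> z"
  with assms have "0 < r" by simp
  with \<tau>_der[of r] p_pos[of r]
  show "\<exists>l. (\<tau> has_real_derivative l) (at r) \<and> l < 0" by (intro exI[of _ "- 1 / p r"]) auto
qed

lemma \<tau>_less_iff: "0 < x \<Longrightarrow> 0 < z \<Longrightarrow> \<tau> z < \<tau> x \<longleftrightarrow> x < z"
  using \<tau>_strict_anti by (metis less_asym linorder_neqE)

text \<open>Taking the range of \<open>\<tau>\<close> avoids a case distinction between finite and
  infinite arrival time at the origin.\<close>

definition "time_dom = \<tau> ` {0<..}"

definition "position = the_inv_into {0<..} \<tau>"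

definition "orbit t = arc_point (position t)"

lemma position_\<tau> [simp]:
  assumes "0 < x"
  shows "position (\<tau> x) = x"
proof -
  have "inj_on \<tau> {0<..}"
    using \<tau>_strict_anti by (intro linorder_inj_onI') (metis greaterThan_iff less_irrefl)
  then show ?thesis
    unfolding position_def using assms by (simp add: the_inv_into_f_f)
qed

lemma orbit_\<tau> [simp]: "0 < x \<Longrightarrow> orbit (\<tau> x) = arc_point x"
  by (simp add: orbit_def)

lemma \<tau>_in_time_dom: "0 < x \<Longrightarrow> \<tau> x \<in> time_dom"
  by (simp add: time_dom_def)

lemma time_domE:
  assumes "t \<in> time_dom"
  obtains x where "0 < x" "t = \<tau> x"
  using assms by (auto simp: time_dom_def)

lemma \<tau>_continuous: "continuous_on {0<..} \<tau>"
  using \<tau>_der by (auto intro!: continuous_at_imp_continuous_on DERIV_isCont)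

lemma is_interval_time_dom: "is_interval time_dom"
  unfolding time_dom_def is_interval_connected_1
  by (intro connected_continuous_image \<tau>_continuous) simp

text \<open>Inverse function theorem: \<open>\<tau>\<close> has the nonzero slope
  \<open>- 1 / p x\<close>.\<close>

lemma position_der:
  assumes x: "0 < x"
  shows "(position has_real_derivative - p x) (at (\<tau> x))"
  unfolding has_field_derivative_def
proof (rule has_derivative_inverse_strong[where S = "{0<..}" and x = x and f = \<tau>
      and f' = "(*) (- 1 / p x)"])
  show "(\<tau> has_derivative (*) (- 1 / p x)) (at x)"
    using \<tau>_der[OF x] by (simp add: has_field_derivative_def)
  show "(*) (- 1 / p x) \<circ> (*) (- p x) = id" using p_pos[OF x] by (auto simp: fun_eq_iff)
qed (use x \<tau>_continuous in auto)

lemma orbit_der: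
  assumes "t \<in> time_dom"
  shows "(orbit has_vector_derivative vfield \<Lambda> \<alpha> c (orbit t)) (at t)"
proof -
  obtain x where x: "0 < x" "t = \<tau> x" using assms by (rule time_domE)
  have pos: "(position has_real_derivative - p x) (at t)"
    using position_der x by simp
  have "(p has_real_derivative (x powr \<alpha> - c * p x) / (\<Lambda> * p x)) (at (position t))"
    using x p_der by simp
  from DERIV_minus[OF DERIV_chain2[OF this pos]]
  have "((\<lambda>s. - p (position s)) has_real_derivative
      - ((x powr \<alpha> - c * p x) / (\<Lambda> * p x) * - p x)) (at t)" .
  \<comment> \<open>The factor \<open>p x\<close> from the chain rule cancels the one in the
    denominator.\<close>
  moreover have "- ((x powr \<alpha> - c * p x) / (\<Lambda> * p x) * - p x) = (1 / \<Lambda>) * (c * (- p x) + x powr \<alpha>)"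
    using \<Lambda> p_pos[OF x(1)] by (simp add: field_simps)
  ultimately have "((\<lambda>s. (position s, - p (position s))) has_vector_derivative
      (- p x, (1 / \<Lambda>) * (c * (- p x) + x powr \<alpha>))) (at t)"
    using pos by (intro has_vector_derivative_Pair)
      (simp_all flip: has_real_derivative_iff_has_vector_derivative)
  then show ?thesis
    using x by (simp add: orbit_def[abs_def] arc_point_def vfield_def)
qed

lemma arc_point_in: "0 < x \<Longrightarrow> arc_point x \<in> Q - {(0, 0)}"
  using p_pos[of x] by (simp add: arc_point_def Q_def)

lemma orbit_image: "orbit ` time_dom = arc_point ` {0<..}"
  by (simp add: time_dom_def image_image)

text \<open>All translates are covered because a competing trajectory will agree with
  \<open>orbit\<close> only up to a shift of time.\<close>

lemma orbit_shift_integral_curve: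
  "integral_curve_on (vfield \<Lambda> \<alpha> c) (Q - {(0, 0)}) ((\<lambda>t. t - d) ` time_dom) (\<lambda>t. orbit (t + d))"
  unfolding integral_curve_on_def
proof (intro conjI ballI)
  show "is_interval ((\<lambda>t. t - d) ` time_dom)"
    using is_interval_time_dom unfolding is_interval_connected_1
    by (intro connected_continuous_image continuous_intros)
  show "(\<lambda>t. orbit (t + d)) ` (\<lambda>t. t - d) ` time_dom \<subseteq> Q - {(0, 0)}"
    using arc_point_in by (simp add: image_image orbit_image image_subset_iff)
  fix t assume "t \<in> (\<lambda>t. t - d) ` time_dom"
  then have "t + d \<in> time_dom" by auto
  have "((\<lambda>t. t + d) has_vector_derivative 1) (at t)"
    by (auto intro!: derivative_eq_intros)
  from vector_diff_chain_at[OF this, of orbit] orbit_der[OF \<open>t + d \<in> time_dom\<close>]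
  have "(orbit \<circ> (\<lambda>t. t + d) has_vector_derivative vfield \<Lambda> \<alpha> c (orbit (t + d))) (at t)"
    by simp
  then show "((\<lambda>t. orbit (t + d)) has_vector_derivative vfield \<Lambda> \<alpha> c (orbit (t + d)))
      (at t within (\<lambda>t. t - d) ` time_dom)"
    by (simp add: o_def has_vector_derivative_at_within)
qed

text \<open>The arc accumulates at the removed origin in one time direction and is unbounded in the
  other, so neither end lies in a compact subset of the domain.\<close>

lemma orbit_maximal:
  assumes curve: "integral_curve_on (vfield \<Lambda> \<alpha> c) (Q - {(0, 0)}) J \<delta>"
    and sub: "time_dom \<subseteq> J" and eq: "\<And>t. t \<in> time_dom \<Longrightarrow> \<delta> t = orbit t"
  shows "J = time_dom"
proof (rule ccontr)
  assume "J \<noteq> time_dom"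
  with sub obtain s where s: "s \<in> J" "s \<notin> time_dom" by auto
  have J: "is_interval J" using curve by (simp add: integral_curve_on_def)
  have \<delta>_cont: "continuous_on J \<delta>"
    using curve unfolding integral_curve_on_def
    by (auto simp: continuous_on_eq_continuous_within intro!: has_vector_derivative_continuous)
  have compact: "compact (\<delta> ` {a..b})" and "{a..b} \<subseteq> J" if "a \<in> J" "b \<in> J" for a b
  proof -
    show "{a..b} \<subseteq> J" using J that by (meson atLeastAtMost_iff mem_is_interval_1_I subsetI)
    then show "compact (\<delta> ` {a..b})"
      using \<delta>_cont by (intro compact_continuous_image) (auto intro: continuous_on_subset)
  qed
  have 1: "\<tau> 1 \<in> J" "\<tau> 1 \<in> time_dom" using sub \<tau>_in_time_dom by auto
  have arc: "arc_point x = \<delta> (\<tau> x)" if "0 < x" for x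
    using eq[OF \<tau>_in_time_dom[OF that]] that by simp
  \<comment> \<open>As \<open>time_dom\<close> is an interval, \<open>s\<close> lies beyond one of
    its ends.\<close>
  have between: "False" if "a \<in> time_dom" "b \<in> time_dom" "a \<le> s" "s \<le> b" for a b
    using s is_interval_time_dom that by (meson mem_is_interval_1_I)
  show False
  proof (cases "\<tau> 1 < s")
    case True
    \<comment> \<open>With \<open>s\<close> past the upper end, every arc point of abscissa below 1
      is visited during \<open>{\<tau> 1..s}\<close>. The compact image then contains their limit,
      the excluded origin.\<close>
    let ?K = "\<delta> ` {\<tau> 1..s}"
    have "arc_point x \<in> ?K" if "0 < x" "x < 1" for x
    proof -
      have "\<tau> 1 < \<tau> x" "\<tau> x \<le> s"
        using between[of "\<tau> 1" "\<tau> x"] 1 \<tau>_in_time_dom[of x] \<tau>_strict_anti[of x 1] True that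
        by (meson linear less_imp_le zero_less_one)+
      then show ?thesis using arc[OF that(1)] by auto
    qed
    then have "\<forall>\<^sub>F x in at_right 0. arc_point x \<in> ?K"
      by (intro eventually_at_rightI[of 0 1]) auto
    moreover have "closed ?K" using compact 1 s by (intro compact_imp_closed) auto
    ultimately have "(0, 0) \<in> ?K"
      using arc_point_tendsto by (intro Lim_in_closed_set[of ?K arc_point "at_right 0"]) auto
    moreover have "?K \<subseteq> Q - {(0, 0)}"
      using curve \<open>\<And>b a. a \<in> J \<Longrightarrow> b \<in> J \<Longrightarrow> {a..b} \<subseteq> J\<close>[OF 1(1) s(1)]
      unfolding integral_curve_on_def by auto
    ultimately show False by auto
  next
    case False
    let ?K = "\<delta> ` {s..\<tau> 1}"
    obtain R where R: "\<And>z. z \<in> ?K \<Longrightarrow> norm z \<le> R"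
      using compact[OF s(1) 1(1)] compact_imp_bounded bounded_iff by metis
    \<comment> \<open>An abscissa larger than the bound \<open>R\<close>, and at least 1 so that its
      time lies between \<open>s\<close> and \<open>\<tau> 1\<close>.\<close>
    define x where "x = max 1 (R + 1)"
    have x: "1 \<le> x" "0 < x" "R < x" by (auto simp: x_def)
    have "\<tau> x \<le> \<tau> 1" using \<tau>_strict_anti[of 1 x] x by (cases "x = 1") auto
    moreover have "s \<le> \<tau> x"
      using between[of "\<tau> x" "\<tau> 1"] 1 \<tau>_in_time_dom[of x] False x
      by (meson linear not_less)
    ultimately have "arc_point x \<in> ?K" using arc[OF x(2)] by auto
    then have "norm (arc_point x) \<le> R" by (rule R)
    moreover have "norm x \<le> norm (arc_point x)" 
      unfolding arc_point_def by (rule norm_fst_le)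
    ultimately show False using x by simp
  qed
qed

lemma orbit_trajectory: "trajectory (vfield \<Lambda> \<alpha> c) (Q - {(0, 0)}) time_dom orbit"
  unfolding trajectory_def
proof (intro conjI allI impI)
  show "integral_curve_on (vfield \<Lambda> \<alpha> c) (Q - {(0, 0)}) time_dom orbit"
    using orbit_shift_integral_curve[of 0] by simp
  show "\<not> orbit constant_on time_dom"
  proof
    assume "orbit constant_on time_dom"
    then obtain z where "\<And>t. t \<in> time_dom \<Longrightarrow> orbit t = z" by (auto simp: constant_on_def)
    from this[OF \<tau>_in_time_dom[of 1]] this[OF \<tau>_in_time_dom[of 2]] show False
      by (auto simp: arc_point_def)
  qed
qed (use orbit_maximal in auto)

text \<open>As \<open>\<tau>\<close> is decreasing, the position is below \<open>e\<close> after
  time \<open>\<tau> e\<close>, while it stays positive; so the limit is that of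
  \<open>arc_point\<close> at 0 from the right.\<close>

lemma orbit_tendsto: "(orbit \<longlongrightarrow> (0, 0)) (upper_end time_dom)"
proof -
  have ev: "\<forall>\<^sub>F t in upper_end time_dom. 0 < position t \<and> position t < e" if "0 < e" for e
  proof -
    \<comment> \<open>The abscissa \<open>e / 2\<close> is reached after \<open>e\<close>, so
      \<open>\<tau> e\<close> is not the last time.\<close>
    have "\<forall>\<^sub>F t in upper_end time_dom. t \<in> time_dom \<and> \<tau> e < t"
      using that is_interval_time_dom \<tau>_in_time_dom \<tau>_strict_anti[of "e / 2" e]
      by (intro eventually_upper_end[where t = "\<tau> (e / 2)"]) auto
    then show ?thesis
      by (rule eventually_mono) (auto elim!: time_domE simp: \<tau>_less_iff that)
  qed
  have "(position \<longlongrightarrow> 0) (upper_end time_dom)"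
  proof (rule tendstoI)
    show "\<forall>\<^sub>F t in upper_end time_dom. dist (position t) 0 < e" if "0 < e" for e
      using ev[OF that] by (rule eventually_mono) simp
  qed
  then have "filterlim position (at_right 0) (upper_end time_dom)"
    using ev[of 1] by (auto simp: filterlim_at elim: eventually_mono)
  from filterlim_compose[OF arc_point_tendsto this] show ?thesis
    by (simp add: orbit_def[abs_def])
qed

end

subsection \<open>Converging trajectories\<close>

text \<open>At a last time \<open>t\<close> continuity would make \<open>\<gamma> t\<close>, a point
  of \<open>S\<close>, equal to the limit \<open>z\<close>.\<close>

lemma trajectory_no_last_time:
  assumes traj: "trajectory X S I \<gamma>" and lim: "(\<gamma> \<longlongrightarrow> z) (upper_end I)" and z: "z \<notin> S"
    and t: "t \<in> I"
  shows "\<exists>s\<in>I. t < s"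
proof (rule ccontr)
  assume "\<not> ?thesis"
  then have max: "\<And>s. s \<in> I \<Longrightarrow> s \<le> t" by (simp add: not_less)
  \<comment> \<open>Nonconstancy supplies an earlier time, so the curve is defined on a left
    neighbourhood of \<open>t\<close>.\<close>
  obtain r where r: "r \<in> I" "r < t"
  proof -
    have "\<not> \<gamma> constant_on I" using traj by (simp add: trajectory_def)
    then show ?thesis using that max by (auto simp: constant_on_def) (metis order_le_imp_less_or_eq)
  qed
  have curve: "integral_curve_on X S I \<gamma>" using traj by (simp add: trajectory_def)
  have rt: "{r..t} \<subseteq> I"
    using curve r t unfolding integral_curve_on_def
    by (meson atLeastAtMost_iff mem_is_interval_1_I subsetI)
  have "continuous_on I \<gamma>"
    using curve unfolding integral_curve_on_def 
    by (auto simp: continuous_on_eq_continuous_within intro!: has_vector_derivative_continuous)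
  then have "continuous_on {r..t} \<gamma>" using rt by (rule continuous_on_subset)
  then have "(\<gamma> \<longlongrightarrow> \<gamma> t) (at_left t)"
    using r(2) by (auto simp: continuous_on_def at_within_Icc_at_left dest!: bspec[of _ _ t])
  moreover have "(\<gamma> \<longlongrightarrow> z) (at_left t)"
  proof -
    have "bdd_above I" using max by (rule bdd_aboveI)
    moreover have "Sup I = t" using t max by (rule cSup_eq_maximum)
    ultimately
    show ?thesis using lim by (simp add: upper_end_def)
  qed
  ultimately have "\<gamma> t = z" by (rule tendsto_unique[rotated]) simp
  then show False using z t curve by (auto simp: integral_curve_on_def)
qed

text \<open>On the boundary of the quadrant the vector field points strictly outwards.\<close>

lemma curve_in_interior:
  assumes \<Lambda>: "0 < \<Lambda>" and curve: "integral_curve_on (vfield \<Lambda> \<alpha> c) (Q - {(0, 0)}) I \<gamma>"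
    and t: "t \<in> I" "s \<in> I" "t < s"
  shows "0 < fst (\<gamma> t) \<and> snd (\<gamma> t) < 0"
proof -
  obtain x y where xy: "\<gamma> t = (x, y)" by fastforce
  have inQ: "0 \<le> fst (\<gamma> r)" "snd (\<gamma> r) \<le> 0" if "r \<in> I" for r
    using curve that by (auto simp: integral_curve_on_def Q_def image_subset_iff split_beta)
  have ts: "{t..s} \<subseteq> I"
    using curve t unfolding integral_curve_on_def
    by (meson atLeastAtMost_iff mem_is_interval_1_I subsetI)
  have xy0: "0 \<le> x" "y \<le> 0" "(x, y) \<noteq> (0, 0)"
    using curve t xy by (auto simp: integral_curve_on_def Q_def image_subset_iff dest!: bspec[of _ _ t])
  have "(\<gamma> has_vector_derivative (y, (1 / \<Lambda>) * (c * y + x powr \<alpha>))) (at t within I)"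
    using curve t xy by (auto simp: integral_curve_on_def vfield_def dest!: bspec[of _ _ t])
  then have "(fst \<circ> \<gamma> has_vector_derivative y) (at t within I)"
    "(snd \<circ> \<gamma> has_vector_derivative (1 / \<Lambda>) * (c * y + x powr \<alpha>)) (at t within I)"
    unfolding o_def
    by (auto dest: bounded_linear.has_vector_derivative[OF bounded_linear_fst]
        bounded_linear.has_vector_derivative[OF bounded_linear_snd])
  then have dx: "((\<lambda>t. fst (\<gamma> t)) has_real_derivative y) (at t within I)"
    and dy: "((\<lambda>t. snd (\<gamma> t)) has_real_derivative (1 / \<Lambda>) * (c * y + x powr \<alpha>)) (at t within I)"
    by (auto simp: has_real_derivative_iff_has_vector_derivative o_def)
  \<comment> \<open>A step forward that is shorter than \<open>d\<close> and stays in
    \<open>{t..s}\<close>; after it the curve would be outside the quadrant.\<close>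
  have small: "t + min d (s - t) / 2 \<in> I" "0 < min d (s - t) / 2" "min d (s - t) / 2 < d"
    if "0 < d" for d
    using ts t that by (auto simp: min_def field_simps)
  have "x \<noteq> 0"
  proof
    assume "x = 0"
    with xy0 have "y < 0" by auto
    from has_real_derivative_neg_dec_right[OF dx this] obtain d where "0 < d"
      "\<And>h. 0 < h \<Longrightarrow> t + h \<in> I \<Longrightarrow> h < d \<Longrightarrow> fst (\<gamma> (t + h)) < fst (\<gamma> t)" by auto
    then have "fst (\<gamma> (t + min d (s - t) / 2)) < 0"
      using small xy \<open>x = 0\<close> by (metis fst_conv)
    then show False using inQ small \<open>0 < d\<close> by (metis not_le)
  qed
  moreover have "y \<noteq> 0"
  proof
    assume "y = 0"
    \<comment> \<open>The origin being excluded, \<open>x > 0\<close>, and then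
      \<open>x powr \<alpha>\<close> is positive even for \<open>\<alpha> = 0\<close>.\<close>
    then have "0 < (1 / \<Lambda>) * (c * y + x powr \<alpha>)" using xy0 \<Lambda> by auto
    from has_real_derivative_pos_inc_right[OF dy this] obtain d where "0 < d"
      "\<And>h. 0 < h \<Longrightarrow> t + h \<in> I \<Longrightarrow> h < d \<Longrightarrow> snd (\<gamma> t) < snd (\<gamma> (t + h))" by auto
    then have "0 < snd (\<gamma> (t + min d (s - t) / 2))"
      using small xy \<open>y = 0\<close> by (metis snd_conv)
    then show False using inQ small \<open>0 < d\<close> by (metis not_le)
  qed
  ultimately show ?thesis using xy xy0 by simp
qed

lemma nonneg_derivative_imp_le:
  fixes f :: "real \<Rightarrow> real"
  assumes I: "is_interval I" "s \<in> I" "t \<in> I" "s \<le> t"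
    and der: "\<And>r. r \<in> I \<Longrightarrow> (f has_real_derivative f' r) (at r within I)"
    and nonneg: "\<And>r. r \<in> I \<Longrightarrow> 0 \<le> f' r"
  shows "f s \<le> f t"
proof -
  have st: "{s..t} \<subseteq> I" using I by (meson atLeastAtMost_iff mem_is_interval_1_I subsetI)
  have "(f has_derivative (*) (f' r)) (at r within {s..t})" if "r \<in> {s..t}" for r
    using der[of r] st that unfolding has_field_derivative_def
    by (meson has_derivative_subset subsetD)
  from mvt_very_simple[OF I(4) this] obtain r where r: "r \<in> {s..t}" "f t - f s = f' r * (t - s)"
    by auto
  then have "0 \<le> f t - f s" using nonneg[of r] st I(4) by auto
  then show ?thesis by simp
qed

context timed_orbit_profile
begin

text \<open>With \<open>D = y\<^sup>2 - p(x)\<^sup>2\<close> one has \<open>D' = (2c/\<Lambda>) y (y + p(x))\<close>; as \<open>y < 0 < p(x)\<close> this gives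
  \<open>D D' \<ge> 0\<close>, so \<open>D\<^sup>2\<close> is nondecreasing. Since it tends to \<open>0\<close>, it vanishes.\<close>

lemma converging_trajectory_on_arc:
  assumes traj: "trajectory (vfield \<Lambda> \<alpha> c) (Q - {(0, 0)}) I \<gamma>"
    and lim: "(\<gamma> \<longlongrightarrow> (0, 0)) (upper_end I)"
    and x_def: "x = (\<lambda>t. fst (\<gamma> t))" and t: "t \<in> I"
  shows "0 < x t" "\<gamma> t = arc_point (x t)" "(x has_real_derivative - p (x t)) (at t within I)"
proof -
  have curve: "integral_curve_on (vfield \<Lambda> \<alpha> c) (Q - {(0, 0)}) I \<gamma>"
    using traj by (simp add: trajectory_def)
  have I: "is_interval I" using curve by (simp add: integral_curve_on_def)
  have later: "\<exists>s\<in>I. r < s" if "r \<in> I" for r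
    using trajectory_no_last_time[OF traj lim _ that] by simp
  define y where "y = (\<lambda>t. snd (\<gamma> t))"
  have sign: "0 < x r" "y r < 0" if "r \<in> I" for r
    using later[OF that] curve_in_interior[OF \<Lambda> curve that] by (auto simp: x_def y_def)
  have dx: "(x has_real_derivative y r) (at r within I)"
    and dy: "(y has_real_derivative (1 / \<Lambda>) * (c * y r + x r powr \<alpha>)) (at r within I)"
    if "r \<in> I" for r
  proof -
    have "(\<gamma> has_vector_derivative (y r, (1 / \<Lambda>) * (c * y r + x r powr \<alpha>))) (at r within I)"
      using curve that
      by (auto simp: integral_curve_on_def vfield_def split_beta x_def y_def dest!: bspec[of _ _ r])
    then show "(x has_real_derivative y r) (at r within I)"
      "(y has_real_derivative (1 / \<Lambda>) * (c * y r + x r powr \<alpha>)) (at r within I)"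
      unfolding x_def y_def has_real_derivative_iff_has_vector_derivative
      by (auto dest: bounded_linear.has_vector_derivative[OF bounded_linear_fst]
          bounded_linear.has_vector_derivative[OF bounded_linear_snd])
  qed
  define D where "D r = (y r)\<^sup>2 - (p (x r))\<^sup>2" for r
  have dD: "(D has_real_derivative 2 * c / \<Lambda> * y r * (y r + p (x r))) (at r within I)"
    if r: "r \<in> I" for r
  proof -
    have dp: "((\<lambda>s. p (x s)) has_real_derivative
        y r * ((x r powr \<alpha> - c * p (x r)) / (\<Lambda> * p (x r)))) (at r within I)"
      using DERIV_chain2[OF p_der[OF sign(1)[OF r]] dx[OF r]] by (simp add: mult.commute)
    have "(D has_real_derivative 2 * y r * ((1 / \<Lambda>) * (c * y r + x r powr \<alpha>)) -
        2 * p (x r) * (y r * ((x r powr \<alpha> - c * p (x r)) / (\<Lambda> * p (x r))))) (at r within I)"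
      unfolding D_def
      by (rule DERIV_cong[OF DERIV_diff[OF DERIV_power[OF dy[OF r], of 2] DERIV_power[OF dp, of 2]]])
         (simp add: algebra_simps)
    moreover have "2 * y r * ((1 / \<Lambda>) * (c * y r + x r powr \<alpha>)) -
        2 * p (x r) * (y r * ((x r powr \<alpha> - c * p (x r)) / (\<Lambda> * p (x r))))
        = 2 * c / \<Lambda> * y r * (y r + p (x r))"
      using \<Lambda> p_pos[OF sign(1)[OF r]] by (simp add: field_simps)
    ultimately show ?thesis by simp
  qed
  have D2_mono: "(D r)\<^sup>2 \<le> (D s)\<^sup>2" if "r \<in> I" "s \<in> I" "r \<le> s" for r s
  proof (rule nonneg_derivative_imp_le[OF I that])
    fix r assume r: "r \<in> I"
    show "((\<lambda>r. (D r)\<^sup>2) has_real_derivative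
        2 * D r * (2 * c / \<Lambda> * y r * (y r + p (x r)))) (at r within I)"
      by (rule DERIV_cong[OF DERIV_power[OF dD[OF r], of 2]]) simp
    \<comment> \<open>Since \<open>D = (y - p) (y + p)\<close>, the product splits into the square
      of \<open>y + p\<close> and \<open>y (y - p)\<close>, whose two factors are negative.\<close>
    have "2 * D r * (2 * c / \<Lambda> * y r * (y r + p (x r)))
        = 4 * c / \<Lambda> * (y r * (y r - p (x r))) * (y r + p (x r))\<^sup>2"
      using \<Lambda> by (simp add: D_def power2_eq_square field_simps)
    also have "0 \<le> \<dots>"
      using c \<Lambda> sign[OF r] p_pos[OF sign(1)[OF r]]
      by (intro mult_nonneg_nonneg mult_nonpos_nonpos) auto
    finally show "0 \<le> 2 * D r * (2 * c / \<Lambda> * y r * (y r + p (x r)))" .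
  qed
  have in_I: "\<forall>\<^sub>F s in upper_end I. s \<in> I \<and> t < s"
    using later[OF t] eventually_upper_end[OF I t] by blast
  have lim_x: "(x \<longlongrightarrow> 0) (upper_end I)" and lim_y: "(y \<longlongrightarrow> 0) (upper_end I)"
    using tendsto_fst[OF lim] tendsto_snd[OF lim] by (simp_all add: x_def y_def)
  have "((\<lambda>s. p (x s)) \<longlongrightarrow> p 0) (upper_end I)"
    by (rule continuous_on_tendsto_compose[OF p_cont lim_x])
       (use in_I sign(1) in \<open>auto elim!: eventually_mono simp: less_imp_le\<close>)
  then have "((\<lambda>s. (D s)\<^sup>2) \<longlongrightarrow> (0\<^sup>2 - 0\<^sup>2)\<^sup>2) (upper_end I)"
    unfolding D_def using lim_y p0 by (intro tendsto_intros) auto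
  moreover have "\<forall>\<^sub>F s in upper_end I. (D t)\<^sup>2 \<le> (D s)\<^sup>2"
    using in_I D2_mono[OF t] by (auto elim!: eventually_mono)
  ultimately have "(D t)\<^sup>2 \<le> (0\<^sup>2 - 0\<^sup>2)\<^sup>2"
    by (rule tendsto_lowerbound[OF _ _ upper_end_neq_bot])
  then have "(y t)\<^sup>2 = (p (x t))\<^sup>2" by (simp add: D_def)
  \<comment> \<open>Equal squares leave \<open>y = p\<close> or \<open>y = - p\<close>; the signs
    exclude the former.\<close>
  then have yt: "y t = - p (x t)"
    using sign[OF t] p_pos[OF sign(1)[OF t]] by (simp add: power2_eq_iff)
  show "0 < x t" by (rule sign[OF t])
  show "\<gamma> t = arc_point (x t)" using yt by (simp add: arc_point_def x_def y_def prod_eq_iff)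
  show "(x has_real_derivative - p (x t)) (at t within I)" using dx[OF t] yt by simp
qed

text \<open>Along the trajectory \<open>\<tau> (x t) - t\<close> has derivative 0, so the trajectory
  is a restriction of a time translate of \<open>orbit\<close>. Its maximality then makes it the
  whole translate.\<close>

lemma converging_trajectory_image:
  assumes traj: "trajectory (vfield \<Lambda> \<alpha> c) (Q - {(0, 0)}) I \<gamma>"
    and lim: "(\<gamma> \<longlongrightarrow> (0, 0)) (upper_end I)"
  shows "\<gamma> ` I = arc_point ` {0<..}"
proof -
  have curve: "integral_curve_on (vfield \<Lambda> \<alpha> c) (Q - {(0, 0)}) I \<gamma>"
    and max: "\<And>J \<delta>. integral_curve_on (vfield \<Lambda> \<alpha> c) (Q - {(0, 0)}) J \<delta> \<Longrightarrow> I \<subseteq> J \<Longrightarrow>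
      \<forall>t\<in>I. \<delta> t = \<gamma> t \<Longrightarrow> J = I"
    using traj unfolding trajectory_def by blast+
  define x where "x = (\<lambda>t. fst (\<gamma> t))"
  note on_arc = converging_trajectory_on_arc[OF traj lim x_def]
  have I: "is_interval I" using curve by (simp add: integral_curve_on_def)
  have "((\<lambda>t. \<tau> (x t) - t) has_real_derivative 0) (at t within I)" if t: "t \<in> I" for t
  proof -
    have "((\<lambda>t. \<tau> (x t)) has_real_derivative - 1 / p (x t) * - p (x t)) (at t within I)"
      by (rule DERIV_chain2[OF \<tau>_der[OF on_arc(1)[OF t]] on_arc(3)[OF t]])
    from DERIV_diff[OF this DERIV_ident] show ?thesis using p_pos[OF on_arc(1)[OF t]] by simp
  qed
  then obtain d where d: "\<And>t. t \<in> I \<Longrightarrow> \<tau> (x t) - t = d"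
    using has_field_derivative_zero_constant[of I "\<lambda>t. \<tau> (x t) - t"] I
    by (auto simp: is_interval_convex_1)
  have shift: "t + d \<in> time_dom \<and> orbit (t + d) = \<gamma> t" if t: "t \<in> I" for t
  proof -
    have "t + d = \<tau> (x t)" using d[OF t] by simp
    then show ?thesis using \<tau>_in_time_dom on_arc(1,2)[OF t] by simp
  qed
  have "(\<lambda>t. t - d) ` time_dom = I"
  proof (rule max[OF orbit_shift_integral_curve])
    show "I \<subseteq> (\<lambda>t. t - d) ` time_dom" using shift by (force simp: image_iff)
  qed (use shift in auto)
  then have "\<gamma> ` I = (\<lambda>t. orbit (t + d)) ` (\<lambda>t. t - d) ` time_dom"
    using shift by (metis (no_types, lifting) image_cong)
  also have "\<dots> = arc_point ` {0<..}" by (simp add: image_image orbit_image)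
  finally show ?thesis .
qed

end

theorem lemma4p8:
  fixes \<Lambda> \<alpha> c :: real
  assumes "\<Lambda> > 0" and "0 \<le> \<alpha>" and "\<alpha> \<le> 1" and "c \<ge> 0"
  shows "\<exists>!C. \<exists>I \<gamma>. trajectory (vfield \<Lambda> \<alpha> c) (Q - {(0, 0)}) I \<gamma> \<and>
                  (\<gamma> \<longlongrightarrow> (0, 0)) (upper_end I) \<and> C = \<gamma> ` I"
proof -
  obtain p where "orbit_profile \<Lambda> \<alpha> c p" using orbit_profile_exists[OF assms] .
  then interpret orbit_profile \<Lambda> \<alpha> c p .
  obtain \<tau> where \<tau>: "\<And>x. 0 < x \<Longrightarrow> (\<tau> has_real_derivative - 1 / p x) (at x)"
    using transit_time_exists by blast
  interpret timed_orbit_profile \<Lambda> \<alpha> c p \<tau> by unfold_locales (rule \<tau>)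
  show ?thesis
  proof (rule ex1I[of _ "orbit ` time_dom"])
    show "\<exists>I \<gamma>. trajectory (vfield \<Lambda> \<alpha> c) (Q - {(0, 0)}) I \<gamma> \<and>
        (\<gamma> \<longlongrightarrow> (0, 0)) (upper_end I) \<and> orbit ` time_dom = \<gamma> ` I"
      using orbit_trajectory orbit_tendsto by blast
  qed (metis converging_trajectory_image orbit_image)
qed

end
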